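(* Let $x_1,\dots,x_n$ be a sample of positive real numbers from the Lomax distribution $LM(\alpha,\sigma)$ with $\alpha,\sigma>0$, let $CV$ be its coefficient of variation, and let $\ell_p$ be the profile log-likelihood function of the Lomax distribution for this sample. If $CV>1$, then $\ell_p(\sigma)$ is monotonically decreasing for all sufficiently large $\sigma$; if $CV<1$, then $\ell_p(\sigma)$ is monotonically increasing for all sufficiently large $\sigma$.
   Context: The Lomax distribution $LM(\alpha,\sigma)$ has density $f(z)=\frac{\alpha}{\sigma}\left(1+\frac{z}{\sigma}\right)^{-\alpha-1}$, $z\ge 0$. For a sample $x_1,\dots,x_n$, the log-likelihood divided by $n$ is $$\ell(\alpha,\sigma)=\log\alpha-\log\sigma-\frac{\alpha+1}{n}\sum_{i=1}^n\log\left(1+\frac{x_i}{\sigma}\right).$$ For fixed $\sigma>0$ it is maximized over $\alpha$ at $\alpha(\sigma)=\frac{n}{\sum_{i=1}^n\log(1+x_i/\sigma)}$, and the profile log-likelihood function is $$\ell_p(\sigma)=\ell(\alpha(\sigma),\sigma)=\log\alpha(\sigma)-\log\sigma-1-\frac{1}{\alpha(\sigma)},\qquad \sigma>0.$$ The coefficient of variation is $CV=s/\mu$, where $\mu=\frac1n\sum_{i=1}^n x_i$ and $s=\sqrt{\frac1n\sum_{i=1}^n x_i^2-\mu^2}$. *)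

theory Defs
  imports "HOL-Probability.Probability" "HOL-Real_Asymp.Real_Asymp"
begin

definition lomax_density :: "real \<Rightarrow> real \<Rightarrow> real \<Rightarrow> real" where
  "lomax_density \<alpha> \<sigma> z = (if 0 \<le> z then \<alpha> / \<sigma> * (1 + z / \<sigma>) powr (- \<alpha> - 1) else 0)"

definition lomax_sample :: "'a measure \<Rightarrow> real \<Rightarrow> real \<Rightarrow> nat \<Rightarrow> (nat \<Rightarrow> 'a \<Rightarrow> real) \<Rightarrow> bool" where
  "lomax_sample M \<alpha> \<sigma> n X \<longleftrightarrow>
     prob_space M \<and>
     prob_space.indep_vars M (\<lambda>_. borel) X {1..n} \<and>
     (\<forall>i\<in>{1..n}. distributed M lborel (X i) (\<lambda>z. ennreal (lomax_density \<alpha> \<sigma> z)))"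

(* log-likelihood divided by n; see lomax_loglik_eq_density *)
definition lomax_loglik :: "nat \<Rightarrow> (nat \<Rightarrow> real) \<Rightarrow> real \<Rightarrow> real \<Rightarrow> real" where
  "lomax_loglik n x \<alpha> \<sigma> =
     ln \<alpha> - ln \<sigma> - (\<alpha> + 1) / real n * (\<Sum>i=1..n. ln (1 + x i / \<sigma>))"

definition lomax_alpha :: "nat \<Rightarrow> (nat \<Rightarrow> real) \<Rightarrow> real \<Rightarrow> real" where
  "lomax_alpha n x \<sigma> = real n / (\<Sum>i=1..n. ln (1 + x i / \<sigma>))"

definition lomax_profile_loglik :: "nat \<Rightarrow> (nat \<Rightarrow> real) \<Rightarrow> real \<Rightarrow> real" where
  "lomax_profile_loglik n x \<sigma> = lomax_loglik n x (lomax_alpha n x \<sigma>) \<sigma>"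

definition sample_mean :: "nat \<Rightarrow> (nat \<Rightarrow> real) \<Rightarrow> real" where
  "sample_mean n x = 1 / real n * (\<Sum>i=1..n. x i)"

definition sample_sd :: "nat \<Rightarrow> (nat \<Rightarrow> real) \<Rightarrow> real" where
  "sample_sd n x = sqrt (1 / real n * (\<Sum>i=1..n. (x i)\<^sup>2) - (sample_mean n x)\<^sup>2)"

definition coeff_variation :: "nat \<Rightarrow> (nat \<Rightarrow> real) \<Rightarrow> real" where
  "coeff_variation n x = sample_sd n x / sample_mean n x"

lemma lomax_loglik_eq_density:
  assumes "0 < n" "0 < \<alpha>" "0 < \<sigma>" "\<forall>i\<in>{1..n}. 0 < x i"
  shows "lomax_loglik n x \<alpha> \<sigma> = ln (\<Prod>i=1..n. lomax_density \<alpha> \<sigma> (x i)) / real n"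
proof -
  have pos: "0 < 1 + x i / \<sigma>" if "i \<in> {1..n}" for i
    using assms that by (auto intro!: add_pos_pos)
  have *: "lomax_density \<alpha> \<sigma> (x i) > 0"
     "ln (lomax_density \<alpha> \<sigma> (x i)) = ln \<alpha> - ln \<sigma> - (\<alpha> + 1) * ln (1 + x i / \<sigma>)"
    if "i \<in> {1..n}" for i
    using assms that pos[OF that]
    by (auto simp: lomax_density_def less_imp_le ln_mult ln_div ln_powr algebra_simps)
  have "ln (\<Prod>i=1..n. lomax_density \<alpha> \<sigma> (x i)) = (\<Sum>i=1..n. ln (lomax_density \<alpha> \<sigma> (x i)))"
    by (intro ln_prod less_imp_neq[THEN not_sym] *(1)) simp_all
  also have "\<dots> = (\<Sum>i=1..n. ln \<alpha> - ln \<sigma> - (\<alpha> + 1) * ln (1 + x i / \<sigma>))"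
    using *(2) by (intro sum.cong) auto
  also have "\<dots> = real n * (ln \<alpha> - ln \<sigma>) - (\<alpha> + 1) * (\<Sum>i=1..n. ln (1 + x i / \<sigma>))"
    by (simp add: sum_subtractf sum_distrib_left)
  finally show ?thesis
    using assms(1) by (simp add: lomax_loglik_def field_simps)
qed

lemma lomax_log_sum_pos:
  fixes x :: "nat \<Rightarrow> real"
  assumes "0 < n" "0 < \<sigma>" "\<forall>i\<in>{1..n}. 0 < x i"
  shows "0 < (\<Sum>i=1..n. ln (1 + x i / \<sigma>))"
proof (rule sum_pos)
  fix i assume "i \<in> {1..n}"
  then have "0 < x i / \<sigma>" using assms by auto
  then show "0 < ln (1 + x i / \<sigma>)" by (intro ln_gt_zero) simp
qed (use assms(1) in auto)

lemma lomax_alpha_maximizes: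
  assumes "0 < n" "0 < \<sigma>" "\<forall>i\<in>{1..n}. 0 < x i" "0 < \<alpha>"
  shows "lomax_loglik n x \<alpha> \<sigma> \<le> lomax_profile_loglik n x \<sigma>"
proof -
  define S where "S = (\<Sum>i=1..n. ln (1 + x i / \<sigma>)) / real n"
  have S: "0 < S" using lomax_log_sum_pos[OF assms(1-3)] assms(1) by (simp add: S_def)
  have "ln (\<alpha> * S) \<le> \<alpha> * S - 1" using S assms(4) by (intro ln_le_minus_one) simp
  then have "ln \<alpha> + ln S \<le> \<alpha> * S - 1" using S assms(4) by (simp add: ln_mult)
  moreover have "lomax_alpha n x \<sigma> = 1 / S" by (simp add: lomax_alpha_def S_def)
  moreover have loglik: "lomax_loglik n x a \<sigma> = ln a - ln \<sigma> - (a + 1) * S" for a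
    by (simp add: lomax_loglik_def S_def)
  ultimately show ?thesis
    using S unfolding lomax_profile_loglik_def loglik by (simp add: ln_div algebra_simps)
qed

lemma lomax_profile_loglik_eq:
  assumes "0 < n" "0 < \<sigma>" "\<forall>i\<in>{1..n}. 0 < x i"
  shows "lomax_profile_loglik n x \<sigma> =
    ln (lomax_alpha n x \<sigma>) - ln \<sigma> - 1 - 1 / lomax_alpha n x \<sigma>"
  using assms(1) lomax_log_sum_pos[OF assms]
  by (simp add: lomax_profile_loglik_def lomax_loglik_def lomax_alpha_def field_simps)

lemma prob_space_lomax:
  assumes "0 < \<alpha>" "0 < \<sigma>"
  shows "prob_space (density lborel (\<lambda>z. ennreal (lomax_density \<alpha> \<sigma> z)))"
proof
  define f where "f z = \<alpha> / \<sigma> * (1 + z / \<sigma>) powr (- \<alpha> - 1)" for z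
  define F where "F z = - ((1 + z / \<sigma>) powr (- \<alpha>))" for z
  have [measurable]: "lomax_density \<alpha> \<sigma> \<in> borel_measurable borel"
    unfolding lomax_density_def by measurable
  have "filterlim (\<lambda>z. 1 + z / \<sigma>) at_top at_top"
    using assms(2) by real_asymp
  then have lim: "(F \<longlongrightarrow> - 0) at_top"
    unfolding F_def using assms(1) by (intro tendsto_minus tendsto_neg_powr) auto
  have "(\<integral>\<^sup>+z. ennreal (lomax_density \<alpha> \<sigma> z) \<partial>lborel) =
        (\<integral>\<^sup>+z. ennreal (f z) * indicator {0..} z \<partial>lborel)"
    by (intro nn_integral_cong) (auto simp: lomax_density_def f_def indicator_def)
  also have "\<dots> = ennreal (- 0 - F 0)"
  proof (rule nn_integral_FTC_atLeast)
    show "f \<in> borel_measurable borel" unfolding f_def by measurable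
    show "DERIV F z :> f z" if "0 \<le> z" for z
    proof -
      have "0 < 1 + z / \<sigma>" using that assms by (simp add: add_pos_nonneg)
      then show ?thesis
        unfolding F_def f_def
        using assms(2) by (auto intro!: derivative_eq_intros simp: powr_diff)
    qed
    show "0 \<le> f z" for z using assms by (simp add: f_def)
  qed (fact lim)
  finally show "emeasure (density lborel (\<lambda>z. ennreal (lomax_density \<alpha> \<sigma> z)))
      (space (density lborel (\<lambda>z. ennreal (lomax_density \<alpha> \<sigma> z)))) = 1"
    by (simp add: emeasure_density F_def)
qed

(* Every vector of positive reals is a realisation of a Lomax sample, so fixing the
   realisation \<omega> of X does not constrain the data beyond positivity. *)
lemma positive_vector_is_lomax_realisation:
  fixes x :: "nat \<Rightarrow> real"
  assumes "1 \<le> n" "0 < \<alpha>" "0 < \<sigma>"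
  shows "\<exists>(M :: (nat \<Rightarrow> real) measure) X \<omega>.
    lomax_sample M \<alpha> \<sigma> n X \<and> \<omega> \<in> space M \<and> (\<forall>i\<in>{1..n}. x i = X i \<omega>)"
proof (intro exI conjI)
  define D where "D = density lborel (\<lambda>z. ennreal (lomax_density \<alpha> \<sigma> z))"
  define M where "M = PiM {1..n} (\<lambda>_. D)"
  define X :: "nat \<Rightarrow> (nat \<Rightarrow> real) \<Rightarrow> real" where "X i \<omega> = \<omega> i" for i \<omega>
  have meas: "lomax_density \<alpha> \<sigma> \<in> borel_measurable borel"
    unfolding lomax_density_def by measurable
  have D: "prob_space D" unfolding D_def using assms(2,3) by (rule prob_space_lomax)
  have sets_D: "sets D = sets borel" by (simp add: D_def)
  interpret M: prob_space M unfolding M_def by (intro prob_space_PiM D)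
  have X: "X i \<in> measurable M D" if "i \<in> {1..n}" for i
    using that unfolding M_def X_def by simp
  have distr_D: "distr M D (X i) = D" if "i \<in> {1..n}" for i
    using distr_PiM_component[of "{1..n}" "\<lambda>_. D" i] D that by (simp add: M_def X_def[abs_def])
  have distr: "distr M N (X i) = D" if "i \<in> {1..n}" "sets N = sets borel" for i N
    using distr_D[OF that(1)] that(2) sets_D by (metis distr_cong)
  have X_N: "X i \<in> measurable M N" if "i \<in> {1..n}" "sets N = sets borel" for i N
    using X[OF that(1)] that(2) sets_D by (metis measurable_cong_sets)
  have "M.indep_vars (\<lambda>_. borel) X {1..n}"
  proof (subst M.indep_vars_iff_distr_eq_PiM')
    have sets_P: "sets (PiM {1..n} (\<lambda>_. borel :: real measure)) = sets M"
      unfolding M_def by (intro sets_PiM_cong) (simp_all add: sets_D)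
    have "distr M (PiM {1..n} (\<lambda>_. borel)) (\<lambda>\<omega>. \<lambda>i\<in>{1..n}. X i \<omega>) = distr M M (\<lambda>\<omega>. \<omega>)"
      using sets_P
      by (intro distr_cong) (auto simp: X_def M_def space_PiM PiE_def extensional_restrict)
    also have "\<dots> = PiM {1..n} (\<lambda>i. distr M borel (X i))"
      unfolding distr_id by (subst M_def) (intro PiM_cong refl distr[symmetric]; simp)
    finally show "distr M (PiM {1..n} (\<lambda>_. borel)) (\<lambda>\<omega>. \<lambda>i\<in>{1..n}. X i \<omega>) =
        PiM {1..n} (\<lambda>i. distr M borel (X i))" .
  qed (use assms(1) X_N in auto)
  moreover have "distributed M lborel (X i) (\<lambda>z. ennreal (lomax_density \<alpha> \<sigma> z))"
    if "i \<in> {1..n}" for i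
    unfolding distributed_def using distr[OF that, of lborel] X_N[OF that, of lborel] meas
    by (simp add: D_def)
  ultimately show "lomax_sample M \<alpha> \<sigma> n X"
    using M.prob_space_axioms by (simp add: lomax_sample_def)
  show "restrict x {1..n} \<in> space M" by (simp add: M_def space_PiM D_def)
  show "\<forall>i\<in>{1..n}. x i = X i (restrict x {1..n})" by (simp add: X_def)
qed

end

theory Submission
  imports Defs
begin

text \<open>
  Write \<open>L \<sigma> = (\<Sum>i. ln (1 + x i / \<sigma>))\<close> and \<open>R \<sigma> = (\<Sum>i. x i / (\<sigma> + x i))\<close>. Since
  \<open>L' = - R / \<sigma>\<close>, the derivative of the profile log-likelihood is
  \<open>(R - L + R * L / n) / (\<sigma> * L)\<close>. Expanding at infinity, \<open>\<sigma>\<^sup>2 * (R - L + R * L / n)\<close> tends to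
  \<open>(\<Sum>i. x i)\<^sup>2 / n - (\<Sum>i. (x i)\<^sup>2) / 2\<close>, which is negative if \<open>CV > 1\<close> and positive if \<open>CV < 1\<close>.
\<close>

text \<open>The numerator of the derivative of the profile log-likelihood. The denominator
  \<open>\<sigma> * L\<close> is positive for positive data and \<open>\<sigma> > 0\<close>, so this
  factor alone carries the sign.\<close>

definition lomax_score :: "nat \<Rightarrow> (nat \<Rightarrow> real) \<Rightarrow> real \<Rightarrow> real" where
  "lomax_score n x \<sigma> =
     (\<Sum>i=1..n. x i / (\<sigma> + x i)) - (\<Sum>i=1..n. ln (1 + x i / \<sigma>))
     + (\<Sum>i=1..n. x i / (\<sigma> + x i)) * (\<Sum>i=1..n. ln (1 + x i / \<sigma>)) / real n"

lemma lomax_profile_loglik_has_derivative: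
  assumes n: "0 < n" and \<sigma>: "0 < \<sigma>" and x: "\<forall>i\<in>{1..n}. 0 < x i"
  shows "(lomax_profile_loglik n x has_real_derivative
    lomax_score n x \<sigma> / (\<sigma> * (\<Sum>i=1..n. ln (1 + x i / \<sigma>)))) (at \<sigma>)"
proof -
  define L where "L t = (\<Sum>i=1..n. ln (1 + x i / t))" for t
  define R where "R = (\<Sum>i=1..n. x i / (\<sigma> + x i))"
  have Lpos: "0 < L t" if "0 < t" for t
    using lomax_log_sum_pos[OF n that x] by (simp add: L_def)
  have term_deriv: "((\<lambda>t. ln (1 + x i / t)) has_real_derivative - (x i / (\<sigma> + x i)) / \<sigma>) (at \<sigma>)"
    if "i \<in> {1..n}" for i
  proof -
    have xi: "0 < x i" using x that by blast
    then have "0 < 1 + x i / \<sigma>" using \<sigma> by (simp add: add_pos_pos)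
    then have "((\<lambda>t. ln (1 + x i / t)) has_real_derivative - (x i / \<sigma>\<^sup>2) / (1 + x i / \<sigma>)) (at \<sigma>)"
      using \<sigma> by (auto intro!: derivative_eq_intros simp: power2_eq_square)
    also have "- (x i / \<sigma>\<^sup>2) / (1 + x i / \<sigma>) = - (x i / (\<sigma> + x i)) / \<sigma>"
      using \<sigma> xi by (simp add: divide_simps power2_eq_square)
    finally show ?thesis .
  qed
  have dL: "(L has_real_derivative - R / \<sigma>) (at \<sigma>)"
    unfolding L_def R_def sum_negf[symmetric] sum_divide_distrib
    by (intro DERIV_sum term_deriv)
  have "((\<lambda>t. ln (real n) - ln (L t) - ln t - 1 - L t / real n) has_real_derivative
      (R - L \<sigma> + R * L \<sigma> / real n) / (\<sigma> * L \<sigma>)) (at \<sigma>)"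
    using Lpos[OF \<sigma>] \<sigma> n
    by (auto intro!: derivative_eq_intros dL simp: field_simps)
  \<comment> \<open>Here \<alpha>(t) = n / L t is substituted into the closed form of the profile.
    The equality holds only for positive t, so the derivative is transferred through the open set
    \<open>{0<..}\<close>.\<close>
  moreover have "ln (real n) - ln (L t) - ln t - 1 - L t / real n = lomax_profile_loglik n x t"
    if "t \<in> {0<..}" for t
    using that Lpos[of t] n lomax_profile_loglik_eq[OF n _ x, of t]
    by (simp add: lomax_alpha_def L_def ln_div)
  ultimately have "(lomax_profile_loglik n x has_real_derivative
      (R - L \<sigma> + R * L \<sigma> / real n) / (\<sigma> * L \<sigma>)) (at \<sigma>)"
    using \<sigma> by (elim has_field_derivative_transform_within_open[of _ _ _ "{0<..}"]) auto
  then show ?thesis by (simp add: lomax_score_def L_def R_def)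
qed

text \<open>Both sums behave like (sum of the x i) / \<sigma>, so the first-order terms of their
  difference cancel and \<sigma>^2 is the right scale. To second order, x / (\<sigma> + x) is
  x/\<sigma> - x^2/\<sigma>^2 and ln (1 + x/\<sigma>) is x/\<sigma> - x^2/(2 \<sigma>^2), so each
  difference contributes - x^2/2. The product term needs only first order and takes one factor
  \<sigma> for each sum.\<close>

lemma lomax_score_asymptotics:
  assumes x: "\<forall>i\<in>{1..n}. 0 < x i"
  shows "((\<lambda>\<sigma>. \<sigma>\<^sup>2 * lomax_score n x \<sigma>) \<longlongrightarrow>
    (\<Sum>i=1..n. x i)\<^sup>2 / real n - (\<Sum>i=1..n. (x i)\<^sup>2) / 2) at_top"
proof -
  have "((\<lambda>\<sigma>. \<sigma>\<^sup>2 * (x i / (\<sigma> + x i) - ln (1 + x i / \<sigma>))) \<longlongrightarrow> - ((x i)\<^sup>2 / 2)) at_top"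
    "((\<lambda>\<sigma>. \<sigma> * (x i / (\<sigma> + x i))) \<longlongrightarrow> x i) at_top"
    "((\<lambda>\<sigma>. \<sigma> * ln (1 + x i / \<sigma>)) \<longlongrightarrow> x i) at_top" if "i \<in> {1..n}" for i
  proof -
    have "0 < x i" using x that by blast
    then show "((\<lambda>\<sigma>. \<sigma>\<^sup>2 * (x i / (\<sigma> + x i) - ln (1 + x i / \<sigma>))) \<longlongrightarrow> - ((x i)\<^sup>2 / 2)) at_top"
      "((\<lambda>\<sigma>. \<sigma> * (x i / (\<sigma> + x i))) \<longlongrightarrow> x i) at_top"
      "((\<lambda>\<sigma>. \<sigma> * ln (1 + x i / \<sigma>)) \<longlongrightarrow> x i) at_top"
      by (real_asymp simp: power2_eq_square)+
  qed
  then have "((\<lambda>\<sigma>. (\<Sum>i=1..n. \<sigma>\<^sup>2 * (x i / (\<sigma> + x i) - ln (1 + x i / \<sigma>)))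
      + (\<Sum>i=1..n. \<sigma> * (x i / (\<sigma> + x i))) * (\<Sum>i=1..n. \<sigma> * ln (1 + x i / \<sigma>)) / real n) \<longlongrightarrow>
      (\<Sum>i=1..n. - ((x i)\<^sup>2 / 2)) + (\<Sum>i=1..n. x i) * (\<Sum>i=1..n. x i) / real n) at_top"
    \<comment> \<open>The limit rule for quotients needs a nonzero denominator; for
      \<open>n = 0\<close> all sums are empty.\<close>
    by (cases "n = 0") (auto intro!: tendsto_intros)
  moreover have "(\<Sum>i=1..n. \<sigma>\<^sup>2 * (x i / (\<sigma> + x i) - ln (1 + x i / \<sigma>)))
      + (\<Sum>i=1..n. \<sigma> * (x i / (\<sigma> + x i))) * (\<Sum>i=1..n. \<sigma> * ln (1 + x i / \<sigma>)) / real n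
      = \<sigma>\<^sup>2 * lomax_score n x \<sigma>" for \<sigma>
    unfolding lomax_score_def sum_distrib_left[symmetric] sum_subtractf
    by (simp add: algebra_simps power2_eq_square)
  moreover have "(\<Sum>i=1..n. - ((x i)\<^sup>2 / 2)) + (\<Sum>i=1..n. x i) * (\<Sum>i=1..n. x i) / real n
      = (\<Sum>i=1..n. x i)\<^sup>2 / real n - (\<Sum>i=1..n. (x i)\<^sup>2) / 2"
    by (simp add: sum_negf sum_divide_distrib power2_eq_square)
  ultimately show ?thesis by simp
qed

text \<open>Comparing CV with 1 means comparing the variance B/n - m^2 with m^2, that is, finding
  the sign of B/n - 2 m^2. This is the limit of the scaled score times the negative factor
  -2/n.\<close>

lemma coeff_variation_compare_1:
  assumes n: "0 < n" and x: "\<forall>i\<in>{1..n}. 0 < x i"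
  shows "1 < coeff_variation n x \<longleftrightarrow> (\<Sum>i=1..n. x i)\<^sup>2 / real n - (\<Sum>i=1..n. (x i)\<^sup>2) / 2 < 0"
    and "coeff_variation n x < 1 \<longleftrightarrow> 0 < (\<Sum>i=1..n. x i)\<^sup>2 / real n - (\<Sum>i=1..n. (x i)\<^sup>2) / 2"
proof -
  define A where "A = (\<Sum>i=1..n. x i)"
  define B where "B = (\<Sum>i=1..n. (x i)\<^sup>2)"
  define m where "m = sample_mean n x"
  have "0 < A" unfolding A_def using n x by (intro sum_pos) auto
  then have m: "0 < m" "m = A / real n" using n by (auto simp: m_def sample_mean_def A_def)
  \<comment> \<open>Writing m as \<open>sqrt (m\<^sup>2)\<close> reduces both comparisons to the
    radicands: \<open>sqrt\<close> is strictly increasing on all reals, so the sign of the variance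
    does not matter.\<close>
  have cv: "coeff_variation n x = sqrt (B / real n - m\<^sup>2) / sqrt (m\<^sup>2)"
    using m(1) by (simp add: coeff_variation_def sample_sd_def B_def flip: m_def)
  have "B / real n - 2 * m\<^sup>2 = - (2 / real n) * (A\<^sup>2 / real n - B / 2)"
    using n by (simp add: m(2) field_simps power2_eq_square)
  then have *: "m\<^sup>2 < B / real n - m\<^sup>2 \<longleftrightarrow> A\<^sup>2 / real n - B / 2 < 0"
    "B / real n - m\<^sup>2 < m\<^sup>2 \<longleftrightarrow> 0 < A\<^sup>2 / real n - B / 2"
    using n by (smt (verit) divide_pos_pos mult_minus_left mult_less_0_iff zero_less_mult_iff
        of_nat_0_less_iff)+
  show "1 < coeff_variation n x \<longleftrightarrow> (\<Sum>i=1..n. x i)\<^sup>2 / real n - (\<Sum>i=1..n. (x i)\<^sup>2) / 2 < 0"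
    unfolding A_def[symmetric] B_def[symmetric] *[symmetric] cv
    using m(1) by (simp only: less_divide_eq_1_pos real_sqrt_gt_0_iff zero_less_power real_sqrt_less_iff)
  show "coeff_variation n x < 1 \<longleftrightarrow> 0 < (\<Sum>i=1..n. x i)\<^sup>2 / real n - (\<Sum>i=1..n. (x i)\<^sup>2) / 2"
    unfolding A_def[symmetric] B_def[symmetric] *[symmetric] cv
    using m(1) by (simp only: divide_less_eq_1_pos real_sqrt_gt_0_iff zero_less_power real_sqrt_less_iff)
qed

lemma strict_antimono_on_lomax_profile_loglik:
  assumes n: "0 < n" and s: "0 < s" and x: "\<forall>i\<in>{1..n}. 0 < x i"
    and neg: "\<And>\<sigma>. s \<le> \<sigma> \<Longrightarrow> lomax_score n x \<sigma> < 0"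
  shows "strict_antimono_on {s..} (lomax_profile_loglik n x)"
proof (rule monotone_onI)
  fix a b assume ab: "a \<in> {s..}" "b \<in> {s..}" "a < b"
  show "lomax_profile_loglik n x b < lomax_profile_loglik n x a"
  proof (rule DERIV_neg_imp_decreasing[OF ab(3)])
    fix \<sigma> assume "a \<le> \<sigma>" "\<sigma> \<le> b"
    then have \<sigma>: "s \<le> \<sigma>" "0 < \<sigma>" using ab s by auto
    then show "\<exists>y. (lomax_profile_loglik n x has_real_derivative y) (at \<sigma>) \<and> y < 0"
      using lomax_profile_loglik_has_derivative[OF n \<sigma>(2) x]
        divide_neg_pos[OF neg[OF \<sigma>(1)] mult_pos_pos[OF \<sigma>(2) lomax_log_sum_pos[OF n \<sigma>(2) x]]]
      by blast
  qed
qed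

lemma strict_mono_on_lomax_profile_loglik:
  assumes n: "0 < n" and s: "0 < s" and x: "\<forall>i\<in>{1..n}. 0 < x i"
    and pos: "\<And>\<sigma>. s \<le> \<sigma> \<Longrightarrow> 0 < lomax_score n x \<sigma>"
  shows "strict_mono_on {s..} (lomax_profile_loglik n x)"
proof (rule monotone_onI)
  fix a b assume ab: "a \<in> {s..}" "b \<in> {s..}" "a < b"
  show "lomax_profile_loglik n x a < lomax_profile_loglik n x b"
  proof (rule DERIV_pos_imp_increasing[OF ab(3)])
    fix \<sigma> assume "a \<le> \<sigma>" "\<sigma> \<le> b"
    then have \<sigma>: "s \<le> \<sigma>" "0 < \<sigma>" using ab s by auto
    then show "\<exists>y. (lomax_profile_loglik n x has_real_derivative y) (at \<sigma>) \<and> 0 < y"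
      using lomax_profile_loglik_has_derivative[OF n \<sigma>(2) x]
        divide_pos_pos[OF pos[OF \<sigma>(1)] mult_pos_pos[OF \<sigma>(2) lomax_log_sum_pos[OF n \<sigma>(2) x]]]
      by blast
  qed
qed

text \<open>The threshold is moved into the positive reals, where the derivative formula is
  available.\<close>

lemma eventually_at_top_obtain_pos:
  assumes "eventually P (at_top :: real filter)"
  obtains s where "0 < s" "\<And>t. s \<le> t \<Longrightarrow> P t"
proof -
  obtain N where N: "\<And>t. N \<le> t \<Longrightarrow> P t"
    using assms by (auto simp: eventually_at_top_linorder)
  show thesis by (rule that[of "max 1 N"]) (auto intro: N)
qed

theorem theorem2:
  fixes M :: "'a measure" and X :: "nat \<Rightarrow> 'a \<Rightarrow> real" and \<omega> :: 'a
    and x :: "nat \<Rightarrow> real" and n :: nat and \<alpha> \<sigma> :: real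
  assumes "1 \<le> n" and "0 < \<alpha>" and "0 < \<sigma>"
    and "lomax_sample M \<alpha> \<sigma> n X"
    and "\<omega> \<in> space M" and "\<forall>i\<in>{1..n}. x i = X i \<omega>"
    and "\<forall>i\<in>{1..n}. 0 < x i"
  shows "(1 < coeff_variation n x \<longrightarrow>
           (\<exists>s>0. strict_antimono_on {s..} (lomax_profile_loglik n x))) \<and>
         (coeff_variation n x < 1 \<longrightarrow>
           (\<exists>s>0. strict_mono_on {s..} (lomax_profile_loglik n x)))"
proof (intro conjI impI)
  have n: "0 < n" using assms(1) by simp
  note x = assms(7)
  note lim = lomax_score_asymptotics[OF x]
  show "\<exists>s>0. strict_antimono_on {s..} (lomax_profile_loglik n x)" if "1 < coeff_variation n x"
  proof -
    \<comment> \<open>A negative limit forces negative values from some point on.\<close>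
    have "eventually (\<lambda>t. t\<^sup>2 * lomax_score n x t < 0) at_top"
      using order_tendstoD(2)[OF lim] that coeff_variation_compare_1(1)[OF n x] by blast
    then obtain s where s: "0 < s" "\<And>t. s \<le> t \<Longrightarrow> t\<^sup>2 * lomax_score n x t < 0"
      by (rule eventually_at_top_obtain_pos) blast
    \<comment> \<open>The factor \<open>t\<^sup>2\<close> is nonnegative, so the negative sign of
      the product comes from the score.\<close>
    then have "lomax_score n x t < 0" if "s \<le> t" for t
      using that by (fastforce simp: mult_less_0_iff)
    with s(1) strict_antimono_on_lomax_profile_loglik[OF n _ x] show ?thesis by blast
  qed
  show "\<exists>s>0. strict_mono_on {s..} (lomax_profile_loglik n x)" if "coeff_variation n x < 1"
  proof -
    have "eventually (\<lambda>t. 0 < t\<^sup>2 * lomax_score n x t) at_top"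
      using order_tendstoD(1)[OF lim] that coeff_variation_compare_1(2)[OF n x] by blast
    then obtain s where s: "0 < s" "\<And>t. s \<le> t \<Longrightarrow> 0 < t\<^sup>2 * lomax_score n x t"
      by (rule eventually_at_top_obtain_pos) blast
    then have "0 < lomax_score n x t" if "s \<le> t" for t
      using that by (fastforce simp: zero_less_mult_iff)
    with s(1) strict_mono_on_lomax_profile_loglik[OF n _ x] show ?thesis by blast
  qed
qed

end
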